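(* Let $X$ be a set and let $L,M:X\times X\to\mathbb{C}$ be symmetric bi-functions. Then $L$ and $M$ are symmetric $\pm1$-rescalings if and only if $\det_{L}=\det_{M}$ as functions on the collection of finite subsets of $X$.
   Context: A bi-function on a set $X$ is a function $X\times X\to\mathbb{C}$; it is symmetric if $L(x,y)=L(y,x)$ for all $x,y\in X$. For a bi-function $L$ and a finite subset $\{x_{1},\dots,x_{n}\}$ of $X$ with $x_1,\dots,x_n$ distinct, $\det_{L}(x_{1},\dots,x_{n})=\det[L(x_{i},x_{j})]_{i,j=1}^{n}$ (this does not depend on the enumeration). Bi-functions $L$ and $M$ on $X$ are symmetric $\pm1$-rescalings if there is a function $f:X\to\{-1,1\}$ such that $M(x,y)=f(x)f(y)L(x,y)$ for all $x,y\in X$. *)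

theory Defs
  imports Complex_Main "Jordan_Normal_Form.Determinant"
begin

text \<open>A bi-function on \<open>X\<close> is represented by a curried total function on the ambient type;
  only its values on \<open>X \<times> X\<close> are ever constrained or used.\<close>

definition symmetric_bifun :: "'a set \<Rightarrow> ('a \<Rightarrow> 'a \<Rightarrow> complex) \<Rightarrow> bool" where
  "symmetric_bifun X L \<longleftrightarrow> (\<forall>x\<in>X. \<forall>y\<in>X. L x y = L y x)"

definition pm1_rescalings ::
  "'a set \<Rightarrow> ('a \<Rightarrow> 'a \<Rightarrow> complex) \<Rightarrow> ('a \<Rightarrow> 'a \<Rightarrow> complex) \<Rightarrow> bool" where
  "pm1_rescalings X L M \<longleftrightarrow>
     (\<exists>f :: 'a \<Rightarrow> complex. (\<forall>x\<in>X. f x \<in> {-1, 1}) \<and>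
        (\<forall>x\<in>X. \<forall>y\<in>X. M x y = f x * f y * L x y))"

definition bifun_mat :: "('a \<Rightarrow> 'a \<Rightarrow> complex) \<Rightarrow> 'a list \<Rightarrow> complex mat" where
  "bifun_mat L xs = mat (length xs) (length xs) (\<lambda>(i, j). L (xs ! i) (xs ! j))"

text \<open>Only meaningful for finite \<open>S\<close>. The choice of enumeration is immaterial by
  \<open>bifun_det_eq\<close> below; for \<open>S = {}\<close> the value is the empty determinant \<open>1\<close>.\<close>

definition bifun_det :: "('a \<Rightarrow> 'a \<Rightarrow> complex) \<Rightarrow> 'a set \<Rightarrow> complex" where
  "bifun_det L S = det (bifun_mat L (SOME xs. distinct xs \<and> set xs = S))"

lemma det_bifun_mat_cong:
  assumes "distinct xs" "distinct ys" "set xs = set ys"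
  shows "det (bifun_mat L xs) = det (bifun_mat L ys)"
proof -
  define n where "n = length xs"
  from assms have "mset ys = mset xs"
    by (simp add: set_eq_iff_mset_eq_distinct)
  then obtain p where p: "p permutes {..<length xs}" "permute_list p xs = ys"
    by (rule mset_eq_permutation)
  have p0: "p permutes {0..<n}"
    using p(1) by (simp add: n_def atLeast0LessThan)
  have lenys: "length ys = n"
    using p(2) by (auto simp: n_def)
  have ys_nth: "ys ! i = xs ! p i" if "i < n" for i
    using p that by (auto simp: permute_list_nth n_def)
  have plt: "p i < n" if "i < n" for i
    using permutes_in_image[OF p0, of i] that by simp
  let ?A = "bifun_mat L xs"
  let ?B = "mat n n (\<lambda>(i, j). ?A $$ (p i, j))"
  have A: "?A \<in> carrier_mat n n"
    by (simp add: bifun_mat_def n_def)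
  have detB: "det ?B = signof p * det ?A"
    by (rule det_permute_rows[OF A p0])
  have BT: "transpose_mat ?B \<in> carrier_mat n n"
    by simp
  have eq: "transpose_mat (bifun_mat L ys) = mat n n (\<lambda>(i, j). transpose_mat ?B $$ (p i, j))"
    by (rule eq_matI) (auto simp: bifun_mat_def lenys ys_nth plt n_def[symmetric])
  have "det (bifun_mat L ys) = det (transpose_mat (bifun_mat L ys))"
    by (rule det_transpose[symmetric, where n = n]) (simp add: bifun_mat_def lenys)
  also have "\<dots> = signof p * det (transpose_mat ?B)"
    unfolding eq by (rule det_permute_rows[OF BT p0])
  also have "det (transpose_mat ?B) = det ?B"
    by (rule det_transpose[where n = n]) simp
  also have "signof p * det ?B = det ?A"
    unfolding detB by (simp add: sign_def)
  finally show ?thesis by simp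
qed

lemma bifun_det_eq:
  assumes "distinct xs"
  shows "bifun_det L (set xs) = det (bifun_mat L xs)"
proof -
  let ?ys = "SOME ys. distinct ys \<and> set ys = set xs"
  have "distinct ?ys \<and> set ?ys = set xs"
    by (rule someI[where x = xs]) (simp add: assms)
  then show ?thesis
    unfolding bifun_det_def using assms by (intro det_bifun_mat_cong) auto
qed

end

theory Submission
  imports Defs
begin

text \<open>Minors of sizes 1 and 2 give \<open>M x y = s x y * L x y\<close> with signs \<open>s x y = s y x\<close>. Such an
  \<open>s\<close> has the form \<open>f x * f y\<close> on the edges of the support graph of \<open>L\<close> as soon as its product
  around every closed walk is 1: take \<open>f\<close> to be the product along any walk from a root of the
  component. A chord splits a closed walk into two shorter ones, so only chordless cycles matter.
  In the Leibniz expansion of the minor on a chordless cycle all permutations but the two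
  orientations of the cycle contribute equally for \<open>L\<close> and \<open>M\<close>; as these two contribute the same
  amount, equality of the minors forces the product of \<open>s\<close> around the cycle to be 1.\<close>

section \<open>Products along walks\<close>

text \<open>The step from the last entry back to the first is left out, so a closed walk carries its
  closing factor \<open>s (last xs) (hd xs)\<close> separately.\<close>

fun walk_prod :: "('a \<Rightarrow> 'a \<Rightarrow> 'b::comm_monoid_mult) \<Rightarrow> 'a list \<Rightarrow> 'b" where
  "walk_prod s (x # y # zs) = s x y * walk_prod s (y # zs)"
| "walk_prod s _ = 1"

lemma walk_prod_append:
  "walk_prod s (xs @ x # ys) = walk_prod s (xs @ [x]) * walk_prod s (x # ys)"
  by (induction s xs rule: walk_prod.induct) (auto simp: mult_ac)

lemma walk_prod_rev:
  assumes "\<And>x y. s x y = s y x"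
  shows "walk_prod s (rev xs) = walk_prod s xs"
  using assms
proof (induction s xs rule: walk_prod.induct)
  case (1 s x y zs)
  have "walk_prod s (rev (y # zs)) = walk_prod s (y # zs)"
    by (rule "1.IH") (rule "1.prems")
  then show ?case
    using walk_prod_append[of s "rev zs" y "[x]"] "1.prems"[of x y] by (simp add: mult.commute)
qed auto

lemma walk_prod_square:
  assumes "\<And>x y. s x y * s x y = 1"
  shows "walk_prod s xs * walk_prod s xs = 1"
proof (induction xs rule: induct_list012)
  case (3 x y zs)
  have "walk_prod s (x # y # zs) * walk_prod s (x # y # zs) =
      (s x y * s x y) * (walk_prod s (y # zs) * walk_prod s (y # zs))"
    by (simp add: mult_ac)
  then show ?case using 3 assms[of x y] by simp
qed auto

section \<open>Reduction of balance to chordless cycles\<close>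

text \<open>Strong induction on the length: a chord cuts the closed walk into two shorter ones, and
  its factor squares to 1. Since \<open>E\<close> is reflexive, repeated vertices produce chords as
  well, so from length 4 on a chordless closed walk visits distinct vertices.\<close>

lemma closed_walk_balanced:
  fixes s :: "'a \<Rightarrow> 'a \<Rightarrow> 'b::comm_monoid_mult"
  assumes E_refl: "\<And>x. E x x" and E_sym: "\<And>x y. E x y \<Longrightarrow> E y x"
    and s_diag: "\<And>x. s x x = 1" and s_sym: "\<And>x y. s x y = s y x"
    and s_sq: "\<And>x y. s x y * s x y = 1"
    and chordless: "\<And>xs. distinct xs \<Longrightarrow> 3 \<le> length xs \<Longrightarrow> successively E xs \<Longrightarrow>
      E (last xs) (hd xs) \<Longrightarrow>
      (\<And>i j. Suc i < j \<Longrightarrow> j < length xs \<Longrightarrow> (i, j) \<noteq> (0, length xs - 1) \<Longrightarrow> \<not> E (xs ! i) (xs ! j)) \<Longrightarrow>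
      walk_prod s xs * s (last xs) (hd xs) = 1"
  assumes "xs \<noteq> []" "successively E xs" "E (last xs) (hd xs)"
  shows "walk_prod s xs * s (last xs) (hd xs) = 1"
  using assms(7-)
proof (induction xs rule: length_induct)
  case (1 xs)
  let ?n = "length xs"
  note IH = 1(1)[rule_format]
  have nth_E: "E (xs ! i) (xs ! Suc i)" if "Suc i < ?n" for i
    using 1(3) that successively_nth by metis
  show ?case
  proof (cases "\<exists>i j. Suc i < j \<and> j < ?n \<and> (i, j) \<noteq> (0, ?n - 1) \<and> E (xs ! i) (xs ! j)")
    case True
    then obtain i j where ij: "Suc i < j" "j < ?n" "(i, j) \<noteq> (0, ?n - 1)" "E (xs ! i) (xs ! j)"
      by blast
    define as x bs y cs where "as = take i xs" and "x = xs ! i"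
      and "bs = take (j - Suc i) (drop (Suc i) xs)" and "y = xs ! j" and "cs = drop (Suc j) xs"
    have xs: "xs = as @ x # bs @ y # cs"
      using id_take_nth_drop[of i xs] id_take_nth_drop[of "j - Suc i" "drop (Suc i) xs"] ij
      by (simp add: as_def x_def bs_def y_def cs_def)
    \<comment> \<open>A nonempty \<open>bs\<close> makes the outer walk shorter than
      \<open>xs\<close>. As the chord is not the closing edge, \<open>as\<close> or
      \<open>cs\<close> is nonempty, which makes the inner walk shorter.\<close>
    have bs: "bs \<noteq> []" using ij by (simp add: bs_def)
    have ac: "as \<noteq> [] \<or> cs \<noteq> []" using ij by (auto simp: as_def cs_def)
    have Exy: "E x y" using ij by (simp add: x_def y_def)
    have succ: "successively E (as @ x # bs @ y # cs)" using 1(3) xs by simp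
    have inner: "walk_prod s (x # bs @ [y]) * s y x = 1"
      using IH[of "x # bs @ [y]"] succ ac E_sym[OF Exy] unfolding xs
      by (auto simp: successively_append_iff successively_Cons hd_append split: if_splits)
    have outer: "walk_prod s (as @ x # y # cs) * s (last xs) (hd xs) = 1"
      using IH[of "as @ x # y # cs"] succ bs Exy 1(4) unfolding xs
      by (auto simp: successively_append_iff successively_Cons hd_append split: if_splits)
    have "walk_prod s xs = walk_prod s (as @ [x]) * (walk_prod s (x # bs @ [y]) * walk_prod s (y # cs))"
      using walk_prod_append[of s as x "bs @ y # cs"] walk_prod_append[of s "x # bs" y cs]
      by (simp add: xs)
    \<comment> \<open>Insert \<open>s x y * s x y = 1\<close>: one factor closes the inner walk, the
      other is the step along the chord in the outer walk.\<close>
    also have "\<dots> = (walk_prod s (x # bs @ [y]) * s y x) * walk_prod s (as @ [x]) * (s x y * walk_prod s (y # cs))"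
      using arg_cong[OF s_sq[of x y], of "\<lambda>z. z * (walk_prod s (as @ [x]) * (walk_prod s (x # bs @ [y]) * walk_prod s (y # cs)))"]
      by (simp add: s_sym[of y x] mult_ac)
    also have "\<dots> = walk_prod s (as @ x # y # cs)"
      using walk_prod_append[of s as x "y # cs"] by (simp add: inner)
    finally show ?thesis using outer by simp
  next
    case False
    then have nochord: "\<not> E (xs ! i) (xs ! j)"
      if "Suc i < j" "j < ?n" "(i, j) \<noteq> (0, ?n - 1)" for i j
      using that by blast
    consider "?n = 1" | "?n = 2" | "?n = 3" | "4 \<le> ?n"
      using 1(2) length_0_conv[of xs] by linarith
    then show ?thesis
    proof cases
      case 1
      then show ?thesis using s_diag by (auto simp: length_Suc_conv)
    next
      case 2
      then obtain a b where "xs = [a, b]" by (auto simp: length_Suc_conv eval_nat_numeral)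
      then show ?thesis using s_sq[of a b] s_sym[of b a] by simp
    next
      case 3
      then obtain a b c where xs: "xs = [a, b, c]" by (auto simp: length_Suc_conv eval_nat_numeral)
      show ?thesis
      \<comment> \<open>Three positions leave no room for a chord, so repeated vertices are treated
        directly here.\<close>
      proof (cases "distinct xs")
        case True
        show ?thesis by (rule chordless[OF True _ "1.prems"(2,3) nochord]) (use 3 in auto)
      next
        case False
        then consider "a = b" | "b = c" | "a = c" by (auto simp: xs)
        then show ?thesis
          by cases (use s_sq[of a b] s_sq[of a c] s_sym[of b a] s_sym[of c a] in \<open>simp_all add: xs s_diag\<close>)
      qed
    next
      case 4
      \<comment> \<open>If the two positions are neither consecutive nor the two ends, the
        repetition itself is a chord by reflexivity. Otherwise moving one of them to a neighbouring
        position gives a chord; length at least 4 ensures that the new pair is neither consecutive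
        nor the closing pair.\<close>
      have ne: "xs ! i \<noteq> xs ! j" if "i < j" "j < ?n" for i j
      proof
        assume eq: "xs ! i = xs ! j"
        consider "Suc i < j" "(i, j) \<noteq> (0, ?n - 1)" | "i = 0" "j = ?n - 1"
          | "j = Suc i" "Suc j < ?n" | "j = Suc i" "Suc j = ?n"
          using \<open>i < j\<close> \<open>j < ?n\<close>
          by (metis Pair_inject Suc_lessI diff_Suc_1)
        then show False
        proof cases
          case 1
          then show False using nochord[of i j] \<open>j < ?n\<close> eq E_refl[of "xs ! j"] by simp
        next
          case 2
          have "Suc (?n - 2) = ?n - 1" "?n - 1 < ?n" using 4 by auto
          then have "E (xs ! 0) (xs ! (?n - 2))"
            using 2 eq E_sym[OF nth_E[of "?n - 2"]] by simp
          moreover have "Suc 0 < ?n - 2" "?n - 2 < ?n" "(0, ?n - 2) \<noteq> (0, ?n - 1)"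
            using 4 by auto
          ultimately show False using nochord by blast
        next
          case 3
          then have "E (xs ! i) (xs ! Suc j)"
            unfolding eq by (intro nth_E)
          moreover have "Suc i < Suc j" "Suc j < ?n" "(i, Suc j) \<noteq> (0, ?n - 1)"
            using 3 \<open>4 \<le> ?n\<close> by auto
          ultimately show False using nochord by blast
        next
          case 4
          have "Suc (i - 1) = i" "i < ?n" using 4 \<open>4 \<le> ?n\<close> by auto
          then have "E (xs ! (i - 1)) (xs ! j)"
            using nth_E[of "i - 1"] by (simp add: eq)
          moreover have "Suc (i - 1) < j" "j < ?n" "(i - 1, j) \<noteq> (0, ?n - 1)"
            using 4 \<open>4 \<le> ?n\<close> by auto
          ultimately show False using nochord by blast
        qed
      qed
      have "distinct xs" unfolding distinct_conv_nth using ne by (metis linorder_neqE_nat)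
      then show ?thesis by (rule chordless[OF _ _ "1.prems"(2,3) nochord]) (use 4 in auto)
    qed
  qed
qed

section \<open>Vertex signs from balanced walks\<close>

text \<open>Going from the root to \<open>x\<close>, across the edge to \<open>y\<close> and back to
  the root is a closed walk. Its balance says \<open>f x * s x y * f y = 1\<close> when
  \<open>f\<close> is the product along a chosen walk from the root.\<close>

lemma switching_of_balanced:
  fixes s :: "'a \<Rightarrow> 'a \<Rightarrow> 'b::comm_monoid_mult"
  assumes E_refl: "\<And>x. E x x" and E_sym: "\<And>x y. E x y \<Longrightarrow> E y x"
    and s_sym: "\<And>x y. s x y = s y x" and s_sq: "\<And>x y. s x y * s x y = 1"
    and s_diag: "\<And>x. s x x = 1"
    and balanced: "\<And>xs. xs \<noteq> [] \<Longrightarrow> successively E xs \<Longrightarrow> E (last xs) (hd xs) \<Longrightarrow>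
      walk_prod s xs * s (last xs) (hd xs) = 1"
  shows "\<exists>f. (\<forall>x. f x * f x = 1) \<and> (\<forall>x y. E x y \<longrightarrow> s x y = f x * f y)"
proof -
  define walk where "walk r x xs \<longleftrightarrow> xs \<noteq> [] \<and> successively E xs \<and> hd xs = r \<and> last xs = x" for r x xs
  \<comment> \<open>Adjacent vertices are reachable from the same set of roots, so the choice
    operator gives both the same root.\<close>
  define rep where "rep x = (SOME r. \<exists>xs. walk r x xs)" for x
  define w where "w x = (SOME xs. walk (rep x) x xs)" for x
  have w: "walk (rep x) x (w x)" for x
  proof -
    have "walk x x [x]" by (simp add: walk_def)
    then have "\<exists>r xs. walk r x xs" by blast
    then have "\<exists>xs. walk (rep x) x xs" unfolding rep_def by (rule someI_ex)
    then show ?thesis unfolding w_def by (rule someI_ex)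
  qed
  have extend: "walk r y (xs @ [y])" if "walk r x xs" "E x y" for r x y xs
    using that by (auto simp: walk_def successively_append_iff)
  have rep: "rep x = rep y" if "E x y" for x y
  proof -
    have "(\<exists>xs. walk r x xs) \<longleftrightarrow> (\<exists>xs. walk r y xs)" for r
      using extend that E_sym by blast
    then show ?thesis by (simp add: rep_def)
  qed
  have "s x y = walk_prod s (w x) * walk_prod s (w y)" if xy: "E x y" for x y
  proof -
    obtain us where us: "w x = us @ [x]"
      using w[of x] unfolding walk_def by (metis append_butlast_last_id)
    obtain vs where vs: "w y = vs @ [y]"
      using w[of y] unfolding walk_def by (metis append_butlast_last_id)
    \<comment> \<open>Both ends of this walk are the root, so its closing step is a loop with factor
      1.\<close>
    let ?c = "us @ x # y # rev vs"
    have c: "?c = w x @ rev (w y)" by (simp add: us vs)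
    have hd: "hd ?c = rep x" and last: "last ?c = rep x"
      using w[of x] w[of y] rep[OF xy] unfolding c walk_def by (auto simp: last_rev)
    have "successively E (rev (w y))"
      unfolding successively_rev
      by (rule successively_mono[of E]) (use w[of y] E_sym in \<open>auto simp only: walk_def\<close>)
    moreover have "successively E (w x)"
      using w[of x] by (simp add: walk_def)
    ultimately have "successively E ?c"
      unfolding c using xy us vs by (auto simp: successively_append_iff)
    then have "walk_prod s ?c * s (last ?c) (hd ?c) = 1"
      by (intro balanced) (auto simp: hd last E_refl simp del: last.simps hd_append)
    then have "1 = walk_prod s ?c" by (simp only: hd last s_diag mult_1_right)
    also have "\<dots> = walk_prod s (w x) * (s x y * walk_prod s (rev (w y)))"
      using walk_prod_append[of s us x "y # rev vs"] by (simp add: us vs)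
    also have "\<dots> = s x y * (walk_prod s (w x) * walk_prod s (w y))"
      by (simp add: walk_prod_rev[OF s_sym] mult_ac)
    finally show ?thesis
      using s_sq[of x y] by (metis mult.assoc mult_1 mult_1_right)
  qed
  moreover have "walk_prod s (w x) * walk_prod s (w x) = 1" for x
    by (rule walk_prod_square[OF s_sq])
  ultimately show ?thesis
    by (intro exI[of _ "\<lambda>x. walk_prod s (w x)"]) simp
qed

section \<open>Determinants supported on a chordless cycle\<close>

text \<open>Off the diagonal, \<open>A\<close> lives on an n-cycle, and \<open>B\<close> differs
  from it by the sign of the closing edge only. Leibniz terms using both corner entries or neither
  agree. The rotation and its inverse use exactly one, and by symmetry their differences add up to
  plus or minus four times a nonzero product.\<close>

lemma det_ne_of_corner_sign_change:
  fixes A B :: "'a::{idom, ring_char_0} mat"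
  assumes A: "A \<in> carrier_mat n n" and B: "B \<in> carrier_mat n n" and n: "3 \<le> n"
    and sym: "\<And>i j. i < n \<Longrightarrow> j < n \<Longrightarrow> A $$ (i, j) = A $$ (j, i)"
    and flip: "\<And>i j. i < n \<Longrightarrow> j < n \<Longrightarrow>
      A $$ (i, j) = (if (i, j) = (0, n - 1) \<or> (i, j) = (n - 1, 0) then - B $$ (i, j) else B $$ (i, j))"
    and path: "\<And>i. Suc i < n \<Longrightarrow> A $$ (i, Suc i) \<noteq> 0"
    and corner: "A $$ (0, n - 1) \<noteq> 0"
    and chordless: "\<And>i j. Suc i < j \<Longrightarrow> j < n \<Longrightarrow> (i, j) \<noteq> (0, n - 1) \<Longrightarrow> A $$ (i, j) = 0"
  shows "det A \<noteq> det B"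
proof -
  let ?P = "{p. p permutes {0..<n}}"
  define t where "t p = (\<Prod>i = 0..<n. A $$ (i, p i))" for p
  define u where "u p = (\<Prod>i = 0..<n. B $$ (i, p i))" for p
  \<comment> \<open>The rotation \<open>i\<close> to \<open>i + 1\<close> modulo \<open>n\<close>,
    extended by the identity as \<open>permutes\<close> demands.\<close>
  define c where "c i = (if i < n then if Suc i = n then 0 else Suc i else i)" for i
  have plt: "p i < n" if "p \<in> ?P" "i < n" for p i
    using that permutes_in_image[of p "{0..<n}" i] by simp
  have tu: "t p = (if p 0 = n - 1 then - 1 else 1) * (if p (n - 1) = 0 then - 1 else 1) * u p"
    if p: "p \<in> ?P" for p
  proof -
    have "t p = (\<Prod>i = 0..<n. (if i = 0 then if p i = n - 1 then - 1 else 1 else 1) *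
        (if i = n - 1 then if p i = 0 then - 1 else 1 else 1) * B $$ (i, p i))"
      unfolding t_def using n by (intro prod.cong refl) (auto simp: flip plt[OF p])
    also have "\<dots> = (if p 0 = n - 1 then - 1 else 1) * (if p (n - 1) = 0 then - 1 else 1) * u p"
      using n by (simp add: prod.distrib u_def prod.delta)
    finally show ?thesis .
  qed
  \<comment> \<open>Reindexing by \<open>p\<close> transposes every factor, which symmetry of
    \<open>A\<close> undoes.\<close>
  have tinv: "t (Hilbert_Choice.inv p) = t p" if p: "p \<in> ?P" for p
  proof -
    have p': "p permutes {0..<n}" using p by simp
    have "t (Hilbert_Choice.inv p) = (\<Prod>i = 0..<n. A $$ (p i, Hilbert_Choice.inv p (p i)))"
      unfolding t_def using prod.permute[OF p', of "\<lambda>i. A $$ (i, Hilbert_Choice.inv p i)"] by (simp add: o_def)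
    also have "\<dots> = t p"
      unfolding t_def
      using p plt[OF p] by (intro prod.cong refl) (auto simp: permutes_inverses[OF p'] sym)
    finally show ?thesis .
  qed
  have cP: "c \<in> ?P"
  proof -
    have inj: "inj_on c {0..<n}"
      by (rule inj_onI) (auto simp: c_def split: if_splits)
    moreover have "c ` {0..<n} \<subseteq> {0..<n}"
      by (auto simp: c_def)
    ultimately have "c ` {0..<n} = {0..<n}"
      by (simp add: endo_inj_surj)
    then show ?thesis
      using inj by (auto intro!: bij_imp_permutes simp: bij_betw_def c_def)
  qed
  have uniq: "p = c" if p: "p \<in> ?P" and last: "p (n - 1) = 0" and p0: "p 0 \<noteq> n - 1" and "t p \<noteq> 0" for p
  proof -
    have p': "p permutes {0..<n}" using p by simp
    have nz: "A $$ (i, p i) \<noteq> 0" if "i < n" for i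
      using \<open>t p \<noteq> 0\<close> that by (auto simp: t_def)
    \<comment> \<open>In these rows the only entry of \<open>A\<close> farther than one place from
      the diagonal that may be nonzero is the corner in row 0, which \<open>p0\<close>
      excludes.\<close>
    have band: "p i \<le> Suc i \<and> i \<le> Suc (p i)" if "i < n - 1" for i
    proof (rule ccontr)
      assume "\<not> ?thesis"
      then consider "Suc i < p i" | "Suc (p i) < i" by linarith
      then show False
      proof cases
        case 1
        then show False
          using chordless[of i "p i"] nz[of i] plt[OF p, of i] p0 that by (cases "i = 0") auto
      next
        case 2
        then show False
          using chordless[of "p i" i] nz[of i] plt[OF p, of i] sym[of i "p i"] that by (cases "i < n") auto
      qed
    qed
    have inj: "p i = p j \<longleftrightarrow> i = j" for i j
      using permutes_inj[OF p'] by (auto simp: inj_eq)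
    \<comment> \<open>Columns fill up from the left: column 0 belongs to row \<open>n - 1\<close>,
      and earlier rows occupy the columns up to \<open>i\<close>. Within the band only
      \<open>Suc i\<close> remains.\<close>
    have step: "p i = Suc i" if "i < n - 1" for i
      using that
    proof (induction i rule: less_induct)
      case (less i)
      have "p i \<noteq> i"
      proof (cases i)
        case 0
        then show ?thesis using inj[of i "n - 1"] last less.prems by auto
      next
        case (Suc k)
        then show ?thesis using less.IH[of k] inj[of i k] less.prems by auto
      qed
      moreover have "Suc (p i) \<noteq> i"
      proof
        assume *: "Suc (p i) = i"
        then have "p (p i) = i" using less.IH[of "p i"] less.prems by auto
        show False
        proof (cases "p i")
          case 0
          then show ?thesis using inj[of i "n - 1"] last less.prems by auto
        next
          case (Suc k)
          then have "p k = p i" using less.IH[of k] less.prems * by auto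
          then show ?thesis using inj[of k i] * Suc by auto
        qed
      qed
      ultimately show ?case using band[OF less.prems] by linarith
    qed
    show "p = c"
    proof
      fix i
      consider "i < n - 1" | "i = n - 1" | "i \<ge> n" by linarith
      then show "p i = c i"
        using step last permutes_not_in[OF p', of i] n by cases (auto simp: c_def)
    qed
  qed
  have c0: "c 0 = 1" and cl: "c (n - 1) = 0" using n by (auto simp: c_def)
  have c': "c permutes {0..<n}" using cP by simp
  have icP: "Hilbert_Choice.inv c \<in> ?P" using c' by (simp add: permutes_inv)
  have ic0: "Hilbert_Choice.inv c 0 = n - 1" and icl: "Hilbert_Choice.inv c (n - 1) \<noteq> 0"
    using c0 cl n permutes_inv_eq[OF c'] by auto
  \<comment> \<open>The two orientations differ because \<open>n\<close> is at least 3.\<close>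
  have cne: "c \<noteq> Hilbert_Choice.inv c"
  proof
    assume "c = Hilbert_Choice.inv c"
    then have "c 0 = n - 1" using ic0 by metis
    then show False using c0 n by simp
  qed
  have tc: "t c \<noteq> 0"
  proof -
    have "A $$ (i, c i) \<noteq> 0" if "i < n" for i
      using path[of i] corner sym[of 0 "n - 1"] that n by (auto simp: c_def)
    then show ?thesis by (auto simp: t_def)
  qed
  have uc: "u c = - t c" "u (Hilbert_Choice.inv c) = - t c"
    using tu[OF cP] tu[OF icP] tinv[OF cP] c0 cl ic0 icl n by (auto split: if_splits)
  \<comment> \<open>Only the two orientations of the full cycle use the corner exactly once and survive in the expansion.\<close>
  have zero: "t p - u p = 0" if p: "p \<in> ?P" and pc: "p \<noteq> c" "p \<noteq> Hilbert_Choice.inv c" for p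
  proof (rule ccontr)
    assume ne: "t p - u p \<noteq> 0"
    then have "t p \<noteq> 0" using tu[OF p] by (auto split: if_splits)
    have p': "p permutes {0..<n}" using p by simp
    consider "p (n - 1) = 0" "p 0 \<noteq> n - 1" | "p (n - 1) \<noteq> 0" "p 0 = n - 1"
      using tu[OF p] ne by (auto split: if_splits)
    then show False
    proof cases
      case 1
      then show False using uniq[OF p] \<open>t p \<noteq> 0\<close> pc by blast
    next
      case 2
      \<comment> \<open>Inversion exchanges the two corners and keeps the product, which reduces
        this case to the previous one.\<close>
      have "Hilbert_Choice.inv p (n - 1) = 0" "Hilbert_Choice.inv p 0 \<noteq> n - 1"
        using 2 permutes_inv_eq[OF p'] by auto
      then have "Hilbert_Choice.inv p = c"
        using uniq[of "Hilbert_Choice.inv p"] tinv[OF p] \<open>t p \<noteq> 0\<close> p' by (simp add: permutes_inv)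
      then show False using pc permutes_inv_inv[OF p'] by auto
    qed
  qed
  have "det A - det B = (\<Sum>p \<in> ?P. signof p * (t p - u p))"
    unfolding det_def'[OF A] det_def'[OF B] t_def u_def
    by (simp add: sum_subtractf right_diff_distrib)
  also have "\<dots> = (\<Sum>p \<in> {c, Hilbert_Choice.inv c}. signof p * (t p - u p))"
    using cP icP zero by (intro sum.mono_neutral_right) (auto simp: finite_permutations)
  \<comment> \<open>Each orientation contributes \<open>2 * t c\<close> by \<open>uc\<close>, and a
    permutation has the same sign as its inverse.\<close>
  also have "\<dots> = 4 * (signof c * t c)"
    using cne uc tinv[OF cP] sign_inverse[OF permutes_imp_permutation[OF _ c']]
    by (simp add: algebra_simps)
  also have "\<dots> \<noteq> 0"
    using tc by (simp add: sign_def)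
  finally show ?thesis by auto
qed

section \<open>Minors of bi-functions\<close>

text \<open>Every Leibniz term acquires the product of \<open>f\<close> over rows and the product of
  \<open>f\<close> over columns. These are the same product up to order, so together they give
  1.\<close>

lemma bifun_det_rescaling:
  assumes "finite S" and f: "\<And>x. x \<in> S \<Longrightarrow> f x * f x = 1"
    and M: "\<And>x y. x \<in> S \<Longrightarrow> y \<in> S \<Longrightarrow> M x y = f x * f y * L x y"
  shows "bifun_det M S = bifun_det L S"
proof -
  obtain xs where xs: "set xs = S" "distinct xs"
    using finite_distinct_list[OF assms(1)] by blast
  define n where "n = length xs"
  have carrier: "bifun_mat K xs \<in> carrier_mat n n" for K
    by (simp add: bifun_mat_def n_def)
  have xsS: "xs ! i \<in> S" if "i < n" for i
    using xs that by (auto simp: n_def)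
  have "(\<Prod>i = 0..<n. bifun_mat M xs $$ (i, p i)) = (\<Prod>i = 0..<n. bifun_mat L xs $$ (i, p i))"
    if p: "p permutes {0..<n}" for p
  proof -
    have pn: "p i < n" if "i < n" for i
      using permutes_in_image[OF p, of i] that by simp
    have "(\<Prod>i = 0..<n. bifun_mat M xs $$ (i, p i)) =
        (\<Prod>i = 0..<n. f (xs ! i)) * (\<Prod>i = 0..<n. f (xs ! p i)) * (\<Prod>i = 0..<n. bifun_mat L xs $$ (i, p i))"
      unfolding prod.distrib[symmetric]
      using pn by (intro prod.cong refl) (auto simp: bifun_mat_def n_def[symmetric] M xsS)
    also have "(\<Prod>i = 0..<n. f (xs ! p i)) = (\<Prod>i = 0..<n. f (xs ! i))"
      using prod.permute[OF p, of "\<lambda>i. f (xs ! i)"] by (simp add: o_def)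
    also have "(\<Prod>i = 0..<n. f (xs ! i)) * (\<Prod>i = 0..<n. f (xs ! i)) = 1"
      unfolding prod.distrib[symmetric] by (intro prod.neutral) (auto simp: f xsS)
    finally show ?thesis by simp
  qed
  then have "det (bifun_mat M xs) = det (bifun_mat L xs)"
    unfolding det_def'[OF carrier] by (intro sum.cong) auto
  then show ?thesis
    using bifun_det_eq[OF xs(2)] xs(1) by metis
qed

lemma bifun_det_singleton: "bifun_det L {x} = L x x"
  using bifun_det_eq[of "[x]" L] by (simp add: bifun_mat_def det_single)

lemma bifun_det_doubleton:
  assumes "x \<noteq> y"
  shows "bifun_det L {x, y} = L x x * L y y - L x y * L y x"
proof -
  have "bifun_mat L [x, y] \<in> carrier_mat 2 2"
    by (simp add: bifun_mat_def numeral_2_eq_2)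
  then have "det (bifun_mat L [x, y]) = L x x * L y y - L x y * L y x"
    by (subst laplace_expansion_row[of _ 2 0])
      (simp_all add: numeral_2_eq_2 cofactor_def det_single mat_delete_def bifun_mat_def)
  then show ?thesis
    using assms bifun_det_eq[of "[x, y]" L] by simp
qed

text \<open>If the cycle had sign -1, a rescaling of \<open>M\<close>, which keeps the minor, would
  differ from \<open>L\<close> exactly in the sign of the closing edge. The two minors would then be
  different.\<close>

lemma chordless_cycle_balanced:
  fixes L M :: "'a \<Rightarrow> 'a \<Rightarrow> complex" and s :: "'a \<Rightarrow> 'a \<Rightarrow> complex"
  assumes xs: "distinct xs" "3 \<le> length xs"
    and det: "bifun_det L (set xs) = bifun_det M (set xs)"
    and L_sym: "\<And>x y. x \<in> set xs \<Longrightarrow> y \<in> set xs \<Longrightarrow> L x y = L y x"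
    and M: "\<And>x y. x \<in> set xs \<Longrightarrow> y \<in> set xs \<Longrightarrow> M x y = s x y * L x y"
    and s_sym: "\<And>x y. s x y = s y x" and s_sq: "\<And>x y. s x y * s x y = 1"
    and s_diag: "\<And>x. s x x = 1"
    and path: "\<And>i. Suc i < length xs \<Longrightarrow> L (xs ! i) (xs ! Suc i) \<noteq> 0"
    and closed: "L (last xs) (hd xs) \<noteq> 0"
    and chordless: "\<And>i j. Suc i < j \<Longrightarrow> j < length xs \<Longrightarrow> (i, j) \<noteq> (0, length xs - 1) \<Longrightarrow>
      L (xs ! i) (xs ! j) = 0"
  shows "walk_prod s xs * s (last xs) (hd xs) = 1"
proof (rule ccontr)
  assume unbalanced: "walk_prod s xs * s (last xs) (hd xs) \<noteq> 1"
  define n where "n = length xs"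
  define g where "g i = walk_prod s (take (Suc i) xs)" for i
  have g_sq: "g i * g i = 1" for i
    unfolding g_def by (rule walk_prod_square[OF s_sq])
  have n: "3 \<le> n" and ne: "xs \<noteq> []" using xs by (auto simp: n_def)
  have g_0: "g 0 = 1" using ne by (cases xs) (auto simp: g_def)
  have g_Suc: "g (Suc i) = g i * s (xs ! i) (xs ! Suc i)" if "Suc i < n" for i
  proof -
    have "take (Suc (Suc i)) xs = take i xs @ xs ! i # [xs ! Suc i]"
      and "take (Suc i) xs = take i xs @ [xs ! i]"
      using that by (simp_all add: take_Suc_conv_app_nth n_def)
    then show ?thesis
      using walk_prod_append[of s "take i xs" "xs ! i" "[xs ! Suc i]"] by (simp add: g_def)
  qed
  have g_last: "g (n - 1) = walk_prod s xs" using n by (simp add: g_def n_def)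
  have "(walk_prod s xs * s (last xs) (hd xs))\<^sup>2 = 1"
    using walk_prod_square[where s = s and xs = xs, OF s_sq] s_sq[of "last xs" "hd xs"]
    by (simp add: power2_eq_square mult_ac)
  then have minus: "walk_prod s xs * s (last xs) (hd xs) = - 1"
    using unbalanced by (auto simp: power2_eq_1_iff)
  \<comment> \<open>The prefix signs \<open>g\<close> belong to positions whereas a rescaling acts
    on elements; distinctness lets \<open>pos\<close> translate.\<close>
  define pos where "pos x = (THE i. i < n \<and> xs ! i = x)" for x
  have pos: "pos (xs ! i) = i" if "i < n" for i
    unfolding pos_def using xs(1) that nth_eq_iff_index_eq n_def by (intro the_equality) auto
  \<comment> \<open>Rescaling by the prefix products of \<open>s\<close> moves all the disagreement onto the closing edge.\<close>
  define M' where "M' x y = g (pos x) * g (pos y) * M x y" for x y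
  have "bifun_det M' (set xs) = bifun_det M (set xs)"
    by (rule bifun_det_rescaling[where f = "\<lambda>x. g (pos x)"]) (auto simp: M'_def g_sq)
  then have "det (bifun_mat L xs) = det (bifun_mat M' xs)"
    using det bifun_det_eq[OF xs(1)] by metis
  moreover have "det (bifun_mat L xs) \<noteq> det (bifun_mat M' xs)"
  proof (rule det_ne_of_corner_sign_change[OF _ _ n])
    have L_nth: "bifun_mat L xs $$ (i, j) = L (xs ! i) (xs ! j)" if "i < n" "j < n" for i j
      using that by (simp add: bifun_mat_def n_def)
    have M'_nth: "bifun_mat M' xs $$ (i, j) = g i * g j * s (xs ! i) (xs ! j) * L (xs ! i) (xs ! j)"
      if "i < n" "j < n" for i j
    proof -
      have "xs ! i \<in> set xs" "xs ! j \<in> set xs" using that by (simp_all add: n_def)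
      moreover have "bifun_mat M' xs $$ (i, j) = M' (xs ! i) (xs ! j)"
        using that by (simp add: bifun_mat_def n_def)
      ultimately show ?thesis using that by (simp add: M'_def pos M)
    qed
    \<comment> \<open>The prefix products at the two ends together give the sign of the whole path,
      so the closing edge receives the sign of the full cycle.\<close>
    have corner: "g 0 * g (n - 1) * s (xs ! 0) (xs ! (n - 1)) = - 1"
      using minus ne s_sym[of "hd xs" "last xs"]
      unfolding g_last g_0 by (simp add: n_def hd_conv_nth last_conv_nth)
    have nsym: "L (xs ! i) (xs ! j) = L (xs ! j) (xs ! i)" if "i < n" "j < n" for i j
      using L_sym that by (simp add: n_def)
    have upper: "bifun_mat L xs $$ (i, j) =
        (if (i, j) = (0, n - 1) then - bifun_mat M' xs $$ (i, j) else bifun_mat M' xs $$ (i, j))"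
      if "i \<le> j" "j < n" for i j
    proof -
      consider "(i, j) = (0, n - 1)" | "(i, j) \<noteq> (0, n - 1)" "j = i"
        | "(i, j) \<noteq> (0, n - 1)" "j = Suc i" | "(i, j) \<noteq> (0, n - 1)" "Suc i < j"
        using \<open>i \<le> j\<close> by linarith
      then show ?thesis
      proof cases
        case 1
        then show ?thesis using corner n by (simp add: L_nth M'_nth)
      next
        case 2
        then show ?thesis using that by (auto simp: L_nth M'_nth s_diag g_sq)
      next
        case 3
        \<comment> \<open>Neighbouring prefix products differ by exactly the sign of the edge
          between them, so that sign occurs twice and cancels.\<close>
        have "g i * g j * s (xs ! i) (xs ! j) = (g i * g i) * (s (xs ! i) (xs ! j) * s (xs ! i) (xs ! j))"
          using 3 that by (simp add: g_Suc mult_ac)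
        then have "g i * g j * s (xs ! i) (xs ! j) = 1" by (simp add: g_sq s_sq)
        then show ?thesis using 3 that by (auto simp: L_nth M'_nth)
      next
        case 4
        then show ?thesis using that chordless[of i j, folded n_def] by (auto simp: L_nth M'_nth)
      qed
    qed
    fix i j assume ij: "i < n" "j < n"
    show "bifun_mat L xs $$ (i, j) = bifun_mat L xs $$ (j, i)"
      using ij by (simp add: L_nth nsym)
    have M'_sym: "bifun_mat M' xs $$ (i, j) = bifun_mat M' xs $$ (j, i)"
      using ij by (simp add: M'_nth nsym[of i j] s_sym[of "xs ! i" "xs ! j"])
    show "bifun_mat L xs $$ (i, j) =
      (if (i, j) = (0, n - 1) \<or> (i, j) = (n - 1, 0)
       then - bifun_mat M' xs $$ (i, j) else bifun_mat M' xs $$ (i, j))"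
    proof (cases "i \<le> j")
      case True
      then show ?thesis using upper[of i j] ij n by auto
    next
      case False
      have "bifun_mat L xs $$ (i, j) = bifun_mat L xs $$ (j, i)"
        using ij by (simp add: L_nth nsym)
      then show ?thesis using upper[of j i] ij n False M'_sym by auto
    qed
  next
    show "bifun_mat L xs $$ (0, n - 1) \<noteq> 0"
      using closed L_sym[of "hd xs" "last xs"] ne n
      by (simp add: bifun_mat_def n_def hd_conv_nth last_conv_nth)
  qed (use path chordless in \<open>auto simp: bifun_mat_def n_def\<close>)
  ultimately show False by simp
qed

section \<open>Equal minors and sign rescalings\<close>

theorem theorem3p4:
  fixes X :: "'a set" and L M :: "'a \<Rightarrow> 'a \<Rightarrow> complex"
  assumes "symmetric_bifun X L" and "symmetric_bifun X M"
  shows "pm1_rescalings X L M \<longleftrightarrow>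
    (\<forall>S. finite S \<and> S \<subseteq> X \<longrightarrow> bifun_det L S = bifun_det M S)"
proof
  assume "pm1_rescalings X L M"
  then obtain f where f: "\<And>x. x \<in> X \<Longrightarrow> f x \<in> {-1, 1}"
      "\<And>x y. x \<in> X \<Longrightarrow> y \<in> X \<Longrightarrow> M x y = f x * f y * L x y"
    unfolding pm1_rescalings_def by blast
  have f_sq: "f x * f x = 1" if "x \<in> X" for x
    using f(1)[OF that] by auto
  show "\<forall>S. finite S \<and> S \<subseteq> X \<longrightarrow> bifun_det L S = bifun_det M S"
  proof (intro allI impI)
    fix S assume "finite S \<and> S \<subseteq> X"
    then show "bifun_det L S = bifun_det M S"
      by (intro bifun_det_rescaling[where f = f, symmetric] f_sq f(2)) auto
  qed
next
  assume det: "\<forall>S. finite S \<and> S \<subseteq> X \<longrightarrow> bifun_det L S = bifun_det M S"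
  have L_sym: "L x y = L y x" if "x \<in> X" "y \<in> X" for x y
    using assms(1) that by (simp add: symmetric_bifun_def)
  have M_sym: "M x y = M y x" if "x \<in> X" "y \<in> X" for x y
    using assms(2) that by (simp add: symmetric_bifun_def)
  \<comment> \<open>The support graph of \<open>L\<close> on \<open>X\<close>, with a loop at every
    point of the type so that \<open>E\<close> is reflexive.\<close>
  define E where "E x y \<longleftrightarrow> x = y \<or> x \<in> X \<and> y \<in> X \<and> L x y \<noteq> 0" for x y
  \<comment> \<open>The default 1 outside \<open>X\<close> and wherever \<open>M\<close> and
    \<open>L\<close> agree makes the sign laws hold on the whole type.\<close>
  define s :: "'a \<Rightarrow> 'a \<Rightarrow> complex"
    where "s x y = (if x \<in> X \<and> y \<in> X \<and> M x y \<noteq> L x y then - 1 else 1)" for x y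
  have diag: "M x x = L x x" if "x \<in> X" for x
    using det[rule_format, of "{x}"] that by (simp add: bifun_det_singleton)
  have M: "M x y = s x y * L x y" if "x \<in> X" "y \<in> X" for x y
  proof (cases "x = y")
    case False
    \<comment> \<open>In the minors of size two the diagonal products cancel, leaving equal
      squares.\<close>
    have "L x y * L x y = M x y * M x y"
      using det[rule_format, of "{x, y}"] that False L_sym[OF that] M_sym[OF that]
      by (simp add: bifun_det_doubleton diag)
    then show ?thesis using that by (auto simp: s_def square_eq_iff)
  qed (use that diag in \<open>simp add: s_def\<close>)
  have s_sym: "s x y = s y x" and s_sq: "s x y * s x y = 1" and s_diag: "s x x = 1" for x y
    using L_sym M_sym by (auto simp: s_def diag)
  have E_refl: "E x x" for x by (simp add: E_def)
  have E_sym: "E y x" if "E x y" for x y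
    using that L_sym[of x y] by (auto simp: E_def)
  have chordless: "walk_prod s xs * s (last xs) (hd xs) = 1"
    if xs: "distinct xs" "3 \<le> length xs" and walk: "successively E xs" and closed: "E (last xs) (hd xs)"
      and nochord: "\<And>i j. Suc i < j \<Longrightarrow> j < length xs \<Longrightarrow> (i, j) \<noteq> (0, length xs - 1) \<Longrightarrow> \<not> E (xs ! i) (xs ! j)"
    for xs
  proof -
    have ne: "xs \<noteq> []" using xs by auto
    have edge: "xs ! i \<in> X \<and> xs ! Suc i \<in> X \<and> L (xs ! i) (xs ! Suc i) \<noteq> 0" if "Suc i < length xs" for i
    proof -
      have "E (xs ! i) (xs ! Suc i)" using walk that successively_nth by metis
      moreover have "xs ! i \<noteq> xs ! Suc i" using xs that by (simp add: nth_eq_iff_index_eq)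
      ultimately show ?thesis by (simp add: E_def)
    qed
    \<comment> \<open>The last position has no successor, so the edge arriving from its predecessor
      is used there.\<close>
    have "xs ! i \<in> X" if "i < length xs" for i
      using edge[of i] edge[of "i - 1"] that xs(2) by (cases "Suc i < length xs") auto
    then have X: "set xs \<subseteq> X" by (auto simp: in_set_conv_nth)
    have "last xs \<noteq> hd xs"
      using xs ne by (simp add: last_conv_nth hd_conv_nth nth_eq_iff_index_eq)
    then have "L (last xs) (hd xs) \<noteq> 0" using closed by (simp add: E_def)
    moreover have "L (xs ! i) (xs ! j) = 0"
      if "Suc i < j" "j < length xs" "(i, j) \<noteq> (0, length xs - 1)" for i j
    proof -
      have "xs ! i \<in> X" "xs ! j \<in> X" using X that by (auto intro!: subsetD[OF X] nth_mem)
      then show ?thesis using nochord[OF that] by (simp add: E_def)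
    qed
    moreover have "bifun_det L (set xs) = bifun_det M (set xs)" using det X by simp
    moreover have "L x y = L y x" "M x y = s x y * L x y" if "x \<in> set xs" "y \<in> set xs" for x y
      using L_sym M X that by blast+
    ultimately show ?thesis
      using edge by (intro chordless_cycle_balanced[OF xs _ _ _ s_sym s_sq s_diag]) blast+
  qed
  have balanced: "walk_prod s xs * s (last xs) (hd xs) = 1"
    if "xs \<noteq> []" "successively E xs" "E (last xs) (hd xs)" for xs
    by (rule closed_walk_balanced[of E s, OF E_refl E_sym s_diag s_sym s_sq chordless that])
  have "\<exists>f. (\<forall>x. f x * f x = 1) \<and> (\<forall>x y. E x y \<longrightarrow> s x y = f x * f y)"
    by (rule switching_of_balanced[of E s, OF E_refl E_sym s_sym s_sq s_diag balanced])
  then obtain f where f: "\<And>x. f x * f x = 1" "\<And>x y. E x y \<Longrightarrow> s x y = f x * f y"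
    by blast
  have "f x \<in> {-1, 1}" for x
    using f(1)[of x] by (auto simp: square_eq_1_iff)
  \<comment> \<open>Where \<open>L x y = 0\<close> both sides vanish; every other pair in
    \<open>X\<close> is an edge, on which \<open>s\<close> factors through \<open>f\<close>.\<close>
  moreover have "M x y = f x * f y * L x y" if "x \<in> X" "y \<in> X" for x y
    using M[OF that] f(2)[of x y] that by (cases "L x y = 0") (auto simp: E_def)
  ultimately show "pm1_rescalings X L M"
    unfolding pm1_rescalings_def by blast
qed

end
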